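(* Let $K\in\{\mathbb{R},\mathbb{C},\mathbb{H}\}$, let $1\le d<N$ be integers, and let $p\ge 2$ be real. For any matrix $A\in K^{N\times N}$ of rank $d$ with $A_{ii}=1$ for all $i$, $$\left(\sum_{i\ne j}|A_{ij}|^p\right)^{\frac1p}\ge\frac{N}{\left(N^2\left(\beta^{\frac{p}{p-1}}+\frac1M\left(1-\beta^{\frac{p}{p-1}}\right)\right)-N\right)^{1-\frac1p}},$$ where $$\beta=\sqrt{\frac{1}{N-d+2(\dim_{\mathbb{R}}K)^{-1}}},\qquad M=N-d+\frac{(N-d)^2-(N-d)}{2}\dim_{\mathbb{R}}K .$$
   Context: The matrix $A$ is not assumed to be Hermitian or positive semidefinite. The sum is over ordered pairs of distinct indices. For $K=\mathbb{H}$, the rank of $A$ is the rank of the right-linear map $v\mapsto Av$ on the right vector space $\mathbb{H}^N$. *)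

theory Defs
  imports "HOL-Analysis.Analysis"
begin

section \<open>Quaternions\<close>

text \<open>\<^term>\<open>Quat a b c d\<close> stands for $a + bi + cj + dk$.\<close>

datatype quat = Quat (qRe: real) (qI: real) (qJ: real) (qK: real)

lemma quat_eq_iff: "x = y \<longleftrightarrow> qRe x = qRe y \<and> qI x = qI y \<and> qJ x = qJ y \<and> qK x = qK y"
  by (cases x; cases y) simp

instantiation quat :: real_vector
begin

definition zero_quat where "0 = Quat 0 0 0 0"

definition plus_quat where
  "x + y = Quat (qRe x + qRe y) (qI x + qI y) (qJ x + qJ y) (qK x + qK y)"

definition uminus_quat where
  "- x = Quat (- qRe x) (- qI x) (- qJ x) (- qK x)"

definition minus_quat where
  "x - y = Quat (qRe x - qRe y) (qI x - qI y) (qJ x - qJ y) (qK x - qK y)"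

definition scaleR_quat where
  "r *\<^sub>R x = Quat (r * qRe x) (r * qI x) (r * qJ x) (r * qK x)"

instance
  by standard
    (simp_all add: quat_eq_iff zero_quat_def plus_quat_def uminus_quat_def minus_quat_def
      scaleR_quat_def algebra_simps)

end

instantiation quat :: division_ring
begin

definition one_quat where "1 = Quat 1 0 0 0"

definition times_quat where
  "x * y = Quat
     (qRe x * qRe y - qI x * qI y - qJ x * qJ y - qK x * qK y)
     (qRe x * qI y + qI x * qRe y + qJ x * qK y - qK x * qJ y)
     (qRe x * qJ y - qI x * qK y + qJ x * qRe y + qK x * qI y)
     (qRe x * qK y + qI x * qJ y - qJ x * qI y + qK x * qRe y)"

definition inverse_quat where
  "inverse x =
     inverse ((qRe x)\<^sup>2 + (qI x)\<^sup>2 + (qJ x)\<^sup>2 + (qK x)\<^sup>2) *\<^sub>R Quat (qRe x) (- qI x) (- qJ x) (- qK x)"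

definition divide_quat where "x div y = x * inverse y" for x y :: quat

instance
proof
  fix x y z :: quat
  have nz: "(qRe x)\<^sup>2 + (qI x)\<^sup>2 + (qJ x)\<^sup>2 + (qK x)\<^sup>2 \<noteq> 0" if "x \<noteq> 0"
  proof
    assume s: "(qRe x)\<^sup>2 + (qI x)\<^sup>2 + (qJ x)\<^sup>2 + (qK x)\<^sup>2 = 0"
    have "0 \<le> (qRe x)\<^sup>2" "0 \<le> (qI x)\<^sup>2" "0 \<le> (qJ x)\<^sup>2" "0 \<le> (qK x)\<^sup>2" by simp_all
    with s have "(qRe x)\<^sup>2 = 0" "(qI x)\<^sup>2 = 0" "(qJ x)\<^sup>2 = 0" "(qK x)\<^sup>2 = 0" by linarith+
    with that show False by (simp add: quat_eq_iff zero_quat_def)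
  qed
  show "(x * y) * z = x * (y * z)" "1 * x = x" "x * 1 = x"
    "(x + y) * z = x * z + y * z" "x * (y + z) = x * y + x * z"
    by (simp_all add: quat_eq_iff times_quat_def one_quat_def plus_quat_def algebra_simps)
  show "(0::quat) \<noteq> 1" "inverse 0 = (0::quat)"
    by (simp_all add: zero_quat_def one_quat_def inverse_quat_def scaleR_quat_def)
  show "inverse x * x = 1" if "x \<noteq> 0"
    using nz[OF that]
    by (simp add: quat_eq_iff times_quat_def one_quat_def inverse_quat_def scaleR_quat_def
      power2_eq_square divide_simps)
  show "x * inverse x = 1" if "x \<noteq> 0"
    using nz[OF that]
    by (simp add: quat_eq_iff times_quat_def one_quat_def inverse_quat_def scaleR_quat_def
      power2_eq_square divide_simps)
  show "x div y = x * inverse y" by (rule divide_quat_def)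
qed

end

lemma quat_units:
  defines "i \<equiv> Quat 0 1 0 0" and "j \<equiv> Quat 0 0 1 0" and "k \<equiv> Quat 0 0 0 1"
  shows "i * i = -1" "j * j = -1" "k * k = -1" "i * j * k = -1"
  by (simp_all add: i_def j_def k_def times_quat_def one_quat_def uminus_quat_def)

instantiation quat :: euclidean_space
begin

definition inner_quat where
  "inner x y = qRe x * qRe y + qI x * qI y + qJ x * qJ y + qK x * qK y"

definition norm_quat where
  "norm x = sqrt ((qRe x)\<^sup>2 + (qI x)\<^sup>2 + (qJ x)\<^sup>2 + (qK x)\<^sup>2)"

definition sgn_quat where "sgn x = x /\<^sub>R norm x" for x :: quat

definition dist_quat where "dist x y = norm (x - y)" for x y :: quat

definition uniformity_quat :: "(quat \<times> quat) filter" where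
  "uniformity_quat = (INF e\<in>{0 <..}. principal {(x, y). dist x y < e})"

definition open_quat :: "quat set \<Rightarrow> bool" where
  "open_quat U \<longleftrightarrow> (\<forall>x\<in>U. eventually (\<lambda>(x', y). x' = x \<longrightarrow> y \<in> U) uniformity)"

definition Basis_quat where
  "Basis = {Quat 1 0 0 0, Quat 0 1 0 0, Quat 0 0 1 0, Quat 0 0 0 1}"

instance
proof
  fix x y z :: quat and r :: real
  show "inner x y = inner y x" "inner (x + y) z = inner x z + inner y z"
    "inner (r *\<^sub>R x) y = r * inner x y"
    by (simp_all add: inner_quat_def plus_quat_def scaleR_quat_def algebra_simps)
  show "0 \<le> inner x x" by (simp add: inner_quat_def)
  show "norm x = sqrt (inner x x)"
    by (simp add: inner_quat_def norm_quat_def power2_eq_square)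
  show "inner x x = 0 \<longleftrightarrow> x = 0"
  proof
    assume s: "inner x x = 0"
    have "0 \<le> (qRe x)\<^sup>2" "0 \<le> (qI x)\<^sup>2" "0 \<le> (qJ x)\<^sup>2" "0 \<le> (qK x)\<^sup>2" by simp_all
    with s have "(qRe x)\<^sup>2 = 0" "(qI x)\<^sup>2 = 0" "(qJ x)\<^sup>2 = 0" "(qK x)\<^sup>2 = 0"
      unfolding inner_quat_def power2_eq_square by linarith+
    then show "x = 0" by (simp add: quat_eq_iff zero_quat_def)
  qed (simp add: inner_quat_def zero_quat_def)
  show "(\<forall>u\<in>Basis. inner x u = 0) \<longleftrightarrow> x = 0"
    by (cases x) (simp add: Basis_quat_def inner_quat_def zero_quat_def)
next
  fix u v :: quat
  assume "u \<in> Basis" "v \<in> Basis"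
  then show "inner u v = (if u = v then 1 else 0)"
    unfolding Basis_quat_def insert_iff empty_iff
    by (elim disjE FalseE) (simp_all add: inner_quat_def)
qed (simp_all add: Basis_quat_def sgn_quat_def dist_quat_def uniformity_quat_def open_quat_def)

end

lemma DIM_quat [simp]: "DIM(quat) = 4"
  by (simp add: Basis_quat_def)

instance quat :: real_normed_div_algebra
proof
  fix x y :: quat and r :: real
  show "r *\<^sub>R x * y = r *\<^sub>R (x * y)" "x * r *\<^sub>R y = r *\<^sub>R (x * y)"
    by (simp_all add: quat_eq_iff times_quat_def scaleR_quat_def algebra_simps)
  show "norm (x * y) = norm x * norm y"
    unfolding norm_quat_def real_sqrt_mult [symmetric] times_quat_def quat.sel
    by (rule arg_cong [where f = sqrt]) algebra
qed


section \<open>Rank over a division ring\<close>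

text \<open>
  The span, independence, dimension and rank of the library are only available over fields.
  The following copies their definitions for the right vector space $K^m$ over a
  division ring $K$. Since \<^term>\<open>A *v x\<close> has the components $\sum_j A_{ij} x_j$, with the
  matrix entry on the left, \<^term>\<open>\<lambda>x. A *v x\<close> is right linear.
\<close>

definition right_scale :: "'a::division_ring ^ 'm \<Rightarrow> 'a \<Rightarrow> 'a ^ 'm" where
  "right_scale x c = (\<chi> i. x $ i * c)"

definition right_span :: "('a::division_ring ^ 'm) set \<Rightarrow> ('a ^ 'm) set" where
  "right_span B = {(\<Sum>v\<in>T. right_scale v (r v)) | T r. finite T \<and> T \<subseteq> B}"

definition right_independent :: "('a::division_ring ^ 'm) set \<Rightarrow> bool" where
  "right_independent B \<longleftrightarrow>
     (\<forall>T r. finite T \<and> T \<subseteq> B \<and> (\<Sum>v\<in>T. right_scale v (r v)) = 0 \<longrightarrow> (\<forall>v\<in>T. r v = 0))"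

definition right_dim :: "('a::division_ring ^ 'm) set \<Rightarrow> nat" where
  "right_dim V =
     (if \<exists>B. right_independent B \<and> right_span B = right_span V
      then card (SOME B. right_independent B \<and> right_span B = right_span V) else 0)"

definition right_rank :: "'a::division_ring ^ 'n ^ 'm \<Rightarrow> nat" where
  "right_rank A = right_dim (range (\<lambda>x. A *v x))"

lemma right_dim_eq_dim: "right_dim V = vec.dim V" for V :: "('a::field ^ 'm) set"
proof -
  have scale: "right_scale v c = c *s v" for v :: "'a ^ 'm" and c
    by (simp add: right_scale_def vec_eq_iff mult.commute)
  have span: "right_span B = vec.span B" for B :: "('a ^ 'm) set"
    by (simp add: right_span_def vec.span_explicit scale)
  have indep: "right_independent B \<longleftrightarrow> vec.independent B" for B :: "('a ^ 'm) set"
    by (auto simp: right_independent_def vec.dependent_explicit scale)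
  show ?thesis
    unfolding right_dim_def vec.dim_def span indep by (rule refl)
qed

lemma right_rank_eq_rank: "right_rank A = rank A" for A :: "real ^ 'n ^ 'm"
  unfolding right_rank_def right_dim_eq_dim rank_dim_range[of A] by (rule dim_vec_eq)


section \<open>The lower bound\<close>

text \<open>In the following, \<open>m\<close> is the dimension of $K$ over the reals.\<close>

definition coh_beta :: "nat \<Rightarrow> nat \<Rightarrow> nat \<Rightarrow> real" where
  "coh_beta m N d = sqrt (1 / (real N - real d + 2 * inverse (real m)))"

definition coh_M :: "nat \<Rightarrow> nat \<Rightarrow> nat \<Rightarrow> real" where
  "coh_M m N d =
     (real N - real d) + ((real N - real d)\<^sup>2 - (real N - real d)) / 2 * real m"

definition coh_bound :: "nat \<Rightarrow> nat \<Rightarrow> nat \<Rightarrow> real \<Rightarrow> real" where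
  "coh_bound m N d p =
     (let b = coh_beta m N d powr (p / (p - 1)); M = coh_M m N d
      in real N / ((real N)\<^sup>2 * (b + 1 / M * (1 - b)) - real N) powr (1 - 1 / p))"

end

theory Submission
  imports Defs
begin

text \<open>
  Let $k = N - d$ and $q = p/(p-1)$. The kernel of $A$ has dimension $k$; let $C$ be the
  orthogonal projection onto it. Since $AC = 0$ and $A$ has unit diagonal, the trace gives
  $k = -\sum_{i \ne j} A_{ij} C_{ji}$, so by Hoelder's inequality it suffices to bound
  $\sum_{i \ne j} |C_{ij}|^q$ from above. Now $C_{ij} = \langle x_i, x_j\rangle$ for vectors
  $x_i \in K^k$ that form a tight frame, and the bound is the value
  at a system of $M$ equiangular lines in $K^k$: one interpolates $s \mapsto s^{q/2}$ by a quadratic that touches it at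
  $s = \beta^2$ and meets it at $s = 1$. The linear term is controlled by tightness, and the
  quadratic term by the fact that the Hermitian $k \times k$ matrices have dimension $M$.
\<close>

section \<open>Conjugation in normed division algebras\<close>

text \<open>
  Treats the three cases uniformly: a norm that is multiplicative and comes from an inner product
  determines the conjugation (it is the identity on the reals).
\<close>

definition cj :: "'a::{real_normed_div_algebra, real_inner} \<Rightarrow> 'a" where
  "cj x = (2 * (x \<bullet> 1)) *\<^sub>R 1 - x"

text \<open>Polarization of the multiplicativity of the norm, in one factor.\<close>

lemma inner_mult_same:
  fixes x y z :: "'a::{real_normed_div_algebra, real_inner}"
  shows "(x * y) \<bullet> (x * z) = (x \<bullet> x) * (y \<bullet> z)" and "(y * x) \<bullet> (z * x) = (y \<bullet> z) * (x \<bullet> x)"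
proof -
  have nn: "(a * b) \<bullet> (a * b) = (a \<bullet> a) * (b \<bullet> b)" for a b :: 'a
    by (simp add: dot_square_norm norm_mult power_mult_distrib)
  show "(x * y) \<bullet> (x * z) = (x \<bullet> x) * (y \<bullet> z)"
    using nn[of x "y + z"] nn[of x y] nn[of x z]
    by (simp add: distrib_left inner_add_left inner_add_right inner_commute algebra_simps)
  show "(y * x) \<bullet> (z * x) = (y \<bullet> z) * (x \<bullet> x)"
    using nn[of "y + z" x] nn[of y x] nn[of z x]
    by (simp add: distrib_right inner_add_left inner_add_right inner_commute algebra_simps)
qed

lemma inner_one_one: "(1::'a::{real_normed_div_algebra, real_inner}) \<bullet> 1 = 1"
  by (simp add: dot_square_norm)

text \<open>Multiplication by \<open>cj x\<close> is adjoint to multiplication by \<open>x\<close>.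
  Expanding \<open>inner_mult_same\<close> for \<open>x + 1\<close> and removing the cases
  \<open>x\<close> and \<open>1\<close> leaves \<open>(x * y) \<bullet> z + y \<bullet> (x * z) = 2
  * (x \<bullet> 1) * (y \<bullet> z)\<close>.\<close>

lemma inner_mult_left_cj: "(x * y) \<bullet> z = y \<bullet> (cj x * z)"
proof -
  have "((x + 1) * y) \<bullet> ((x + 1) * z) = ((x + 1) \<bullet> (x + 1)) * (y \<bullet> z)"
    by (rule inner_mult_same)
  then show ?thesis
    using inner_mult_same(1)[of x y z] inner_mult_same(1)[of 1 y z]
    by (simp add: cj_def inner_add_left inner_add_right inner_diff_left inner_diff_right
      inner_one_one inner_commute distrib_right left_diff_distrib algebra_simps)
qed

lemma inner_mult_right_cj: "(x * y) \<bullet> z = x \<bullet> (z * cj y)"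
proof -
  have "(x * (y + 1)) \<bullet> (z * (y + 1)) = (x \<bullet> z) * ((y + 1) \<bullet> (y + 1))"
    by (rule inner_mult_same)
  then show ?thesis
    using inner_mult_same(2)[of x y z] inner_mult_same(2)[of x 1 z]
    by (simp add: cj_def inner_add_left inner_add_right inner_diff_left inner_diff_right
      inner_one_one inner_commute distrib_left right_diff_distrib algebra_simps)
qed

lemma cj_zero [simp]: "cj 0 = 0"
  by (simp add: cj_def)

lemma cj_cj [simp]: "cj (cj x) = x"
  by (simp add: cj_def inner_diff_left inner_diff_right inner_one_one algebra_simps flip: scaleR_left.diff)

lemma cj_add: "cj (x + y) = cj x + cj y"
  by (simp add: cj_def inner_add algebra_simps)

lemma cj_sum: "cj (\<Sum>i\<in>I. f i) = (\<Sum>i\<in>I. cj (f i))"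
  by (induction I rule: infinite_finite_induct) (auto simp: cj_add)

text \<open>Taking adjoints reverses the order of a product.\<close>

lemma cj_mult: "cj (x * y) = cj y * cj x"
proof -
  have "z \<bullet> cj (x * y) = z \<bullet> (cj y * cj x)" for z
    using inner_mult_left_cj[of "x * y" z 1] inner_mult_left_cj[of x "y * z" 1]
      inner_mult_left_cj[of y z "cj x"]
    by (simp add: mult.assoc)
  then show ?thesis using vector_eq_ldot by blast
qed

lemma norm_cj [simp]: "norm (cj x) = norm x"
  by (simp add: norm_eq_sqrt_inner cj_def inner_diff_left inner_diff_right inner_one_one
      inner_commute algebra_simps)

lemma inner_cj_cj [simp]: "cj x \<bullet> cj y = x \<bullet> y"
  by (simp add: cj_def inner_diff_left inner_diff_right inner_one_one
      inner_commute algebra_simps)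

lemma mult_cj_self: "x * cj x = (norm x)\<^sup>2 *\<^sub>R 1"
proof -
  have "z \<bullet> (x * cj x) = z \<bullet> ((norm x)\<^sup>2 *\<^sub>R 1)" for z
    using inner_mult_right_cj[of z x x] inner_mult_same(2)[of z x 1]
    by (simp add: dot_square_norm)
  then show ?thesis using vector_eq_ldot by blast
qed

lemma cj_mult_self: "cj x * x = (norm x)\<^sup>2 *\<^sub>R 1"
  using mult_cj_self[of "cj x"] by simp

section \<open>Orthonormal kernel vectors\<close>

text \<open>Conjugating the first argument makes the form right linear in \<open>x\<close>, as is
  \<open>A *v x\<close>.\<close>

definition hinner :: "'a::{real_normed_div_algebra, euclidean_space} ^ 'n \<Rightarrow> 'a ^ 'n \<Rightarrow> 'a" where
  "hinner v x = (\<Sum>j\<in>UNIV. cj (v $ j) * x $ j)"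

lemma hinner_self: "hinner v v = (norm v)\<^sup>2 *\<^sub>R 1"
  by (simp add: hinner_def cj_mult_self norm_vec_def L2_set_def sum_nonneg flip: scaleR_left.sum)

lemma hinner_commute: "hinner w v = cj (hinner v w)"
  by (simp add: hinner_def cj_sum cj_mult)

lemma hinner_scaleR_right: "hinner v (r *\<^sub>R x) = r *\<^sub>R hinner v x"
  by (simp add: hinner_def scaleR_sum_right)

text \<open>With \<open>e\<close> ranging over \<open>Basis\<close> this reads off the real
  coordinates of \<open>hinner v x\<close>, so orthogonality over the algebra becomes real
  orthogonality.\<close>

lemma inner_right_scale: "right_scale v e \<bullet> x = e \<bullet> hinner v x"
  by (simp add: hinner_def right_scale_def inner_vec_def inner_sum_right inner_mult_left_cj)

text \<open>A real dimension count: at most \<open>card S * DIM('a)\<close> real linear conditions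
  in a space of real dimension \<open>CARD('n) * DIM('a)\<close>.\<close>

lemma exists_hinner_orthogonal:
  fixes S :: "('a::{real_normed_div_algebra, euclidean_space} ^ 'n) set"
  assumes "finite S" "card S < CARD('n)"
  shows "\<exists>x. norm x = 1 \<and> (\<forall>v\<in>S. hinner v x = 0)"
proof -
  define R where "R = (\<lambda>(v, e). right_scale v e) ` (S \<times> (Basis :: 'a set))"
  have "finite R" using assms by (simp add: R_def)
  have "card R \<le> card S * DIM('a)"
    unfolding R_def by (metis card_image_le card_cartesian_product finite_Basis finite_SigmaI assms(1))
  also have "\<dots> < DIM('a ^ 'n)" using assms by simp
  finally have "dim R < DIM('a ^ 'n)"
    using dim_le_card'[OF \<open>finite R\<close>] by linarith
  then obtain x where x: "x \<noteq> 0" "\<And>y. y \<in> span R \<Longrightarrow> orthogonal x y"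
    using orthogonal_to_subspace_exists[of R] by auto
  have "hinner v x = 0" if "v \<in> S" for v
  proof (rule euclidean_eqI)
    fix e :: 'a assume "e \<in> Basis"
    then have "right_scale v e \<in> R" using that by (auto simp: R_def)
    then have "orthogonal x (right_scale v e)" using x(2) span_base by blast
    then show "hinner v x \<bullet> e = 0 \<bullet> e"
      using inner_right_scale[of v e x] by (simp add: orthogonal_def inner_commute)
  qed
  then show ?thesis using x(1)
    by (intro exI[of _ "x /\<^sub>R norm x"]) (simp add: hinner_scaleR_right)
qed

text \<open>Induction on \<open>k\<close>: the vectors already found join \<open>S\<close>, and
  \<open>exists_hinner_orthogonal\<close> supplies the next one.\<close>

lemma exists_orthonormal:
  fixes S :: "('a::{real_normed_div_algebra, euclidean_space} ^ 'n) set"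
  assumes "finite S" "card S + k \<le> CARD('n)"
  shows "\<exists>u. (\<forall>a<k. norm (u a) = 1) \<and> (\<forall>a<k. \<forall>b<k. a \<noteq> b \<longrightarrow> hinner (u a) (u b) = 0)
    \<and> (\<forall>a<k. \<forall>v\<in>S. hinner v (u a) = 0)"
  using assms(2)
proof (induction k)
  case (Suc k)
  then obtain u where u: "\<forall>a<k. norm (u a) = 1" "\<forall>a<k. \<forall>b<k. a \<noteq> b \<longrightarrow> hinner (u a) (u b) = 0"
    "\<forall>a<k. \<forall>v\<in>S. hinner v (u a) = 0" by auto
  have "card (S \<union> u ` {..<k}) \<le> card S + k"
    by (metis card_Un_le card_image_le card_lessThan finite_lessThan add_left_mono le_trans)
  then obtain x where x: "norm x = 1" "\<forall>v\<in>S \<union> u ` {..<k}. hinner v x = 0"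
    using exists_hinner_orthogonal[of "S \<union> u ` {..<k}"] Suc.prems assms(1) by auto
  then have "hinner x (u a) = 0" if "a < k" for a
    using that hinner_commute[of x "u a"] by simp
  with u x show ?case
    by (intro exI[of _ "u(k := x)"]) (auto simp: less_Suc_eq)
qed simp

section \<open>Rank factorization and the kernel\<close>

lemma right_span_base:
  assumes "y \<in> R"
  shows "y \<in> right_span R"
proof -
  have "y = (\<Sum>v\<in>{y}. right_scale v ((\<lambda>_. 1) v))"
    by (simp add: right_scale_def)
  moreover have "finite {y} \<and> {y} \<subseteq> R" using assms by simp
  ultimately show ?thesis
    unfolding right_span_def mem_Collect_eq
    by (intro exI[of _ "{y}"] exI[of _ "\<lambda>_. 1"]) (rule conjI)
qed

text \<open>The columns of \<open>A\<close> lie in its range and are right combinations of a basis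
  \<open>B\<close> of the span of that range.\<close>

lemma right_rank_factor:
  fixes A :: "'a::division_ring ^ 'n ^ 'm"
  assumes "right_rank A = d" "d \<noteq> 0"
  shows "\<exists>B c. finite B \<and> card B = d \<and> (\<forall>i j. A $ i $ j = (\<Sum>v\<in>B. v $ i * c v j))"
proof -
  define R where "R = range (\<lambda>x. A *v x)"
  \<comment> \<open>\<open>d \<noteq> 0\<close> excludes the default value 0 of
    \<open>right_dim\<close>, so a basis exists; as \<open>card\<close> is 0 on infinite sets, it
    also makes \<open>B\<close> finite.\<close>
  have ex: "\<exists>B. right_independent B \<and> right_span B = right_span R"
    using assms unfolding right_rank_def right_dim_def R_def by (auto split: if_splits)
  define B where "B = (SOME B. right_independent B \<and> right_span B = right_span R)"
  have B: "right_span B = right_span R" using someI_ex[OF ex] by (simp add: B_def)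
  have card: "card B = d"
    using assms(1) ex unfolding right_rank_def right_dim_def R_def[symmetric] B_def by simp
  then have fin: "finite B" using assms(2) card.infinite by fastforce
  have "\<exists>g. \<forall>i. A $ i $ j = (\<Sum>v\<in>B. v $ i * g v)" for j
  proof -
    define y where "y = A *v axis j 1"
    have "y \<in> R" by (simp add: R_def y_def)
    then have "y \<in> right_span B" unfolding B by (rule right_span_base)
    then obtain T r where T: "finite T" "T \<subseteq> B" "y = (\<Sum>v\<in>T. right_scale v (r v))"
      unfolding right_span_def by (elim CollectE exE conjE)
    have "A $ i $ j = (\<Sum>v\<in>B. v $ i * (if v \<in> T then r v else 0))" for i
    proof -
      have "A $ i $ j = y $ i"
        by (simp add: y_def matrix_vector_mult_def axis_def if_distrib cong: if_cong)
      also have "\<dots> = (\<Sum>v\<in>T. v $ i * r v)" by (simp add: T right_scale_def)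
      also have "\<dots> = (\<Sum>v\<in>B. v $ i * (if v \<in> T then r v else 0))"
        by (rule sum.mono_neutral_cong_left) (use T fin in auto)
      finally show ?thesis .
    qed
    then show ?thesis by (intro exI[of _ "\<lambda>v. if v \<in> T then r v else 0"] allI)
  qed
  then obtain c where "\<And>j i. A $ i $ j = (\<Sum>v\<in>B. v $ i * c j v)" by metis
  then show ?thesis using fin card by (intro exI[of _ B] exI[of _ "\<lambda>v j. c j v"]) auto
qed

text \<open>By the factorization, a vector is in the kernel once \<open>d\<close> functionals with
  coefficients \<open>c v j\<close> vanish on it; these are \<open>hinner\<close> against the
  vectors with entries \<open>cj (c v j)\<close>.\<close>

lemma exists_orthonormal_kernel:
  fixes A :: "'a::{real_normed_div_algebra, euclidean_space} ^ 'n ^ 'm"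
  assumes "right_rank A = d" "d \<noteq> 0" "d + k \<le> CARD('n)"
  shows "\<exists>u. (\<forall>a<k. norm (u a) = 1) \<and> (\<forall>a<k. \<forall>b<k. a \<noteq> b \<longrightarrow> hinner (u a) (u b) = 0)
    \<and> (\<forall>a<k. A *v u a = 0)"
proof -
  obtain B c where B: "finite B" "card B = d" "\<And>i j. A $ i $ j = (\<Sum>v\<in>B. v $ i * c v j)"
    using right_rank_factor[OF assms(1,2)] by blast
  define S where "S = (\<lambda>v. \<chi> j. cj (c v j)) ` B"
  have S: "finite S" "card S \<le> d" using B card_image_le by (auto simp: S_def)
  then obtain u :: "nat \<Rightarrow> 'a ^ 'n" where u: "\<forall>a<k. norm (u a) = 1"
      "\<forall>a<k. \<forall>b<k. a \<noteq> b \<longrightarrow> hinner (u a) (u b) = 0" "\<forall>a<k. \<forall>v\<in>S. hinner v (u a) = 0"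
    using exists_orthonormal[of S k] assms(3) by auto
  have "A *v u a = 0" if "a < k" for a
  proof -
    have *: "(\<Sum>j\<in>UNIV. c v j * u a $ j) = 0" if "v \<in> B" for v
      using u(3) \<open>a < k\<close> that by (auto simp: S_def hinner_def)
    have "(A *v u a) $ i = (\<Sum>v\<in>B. v $ i * (\<Sum>j\<in>UNIV. c v j * u a $ j))" for i
      unfolding matrix_vector_mult_def B(3) vec_lambda_beta sum_distrib_left sum_distrib_right
      by (subst sum.swap) (simp add: mult.assoc)
    then show ?thesis using * by (simp add: vec_eq_iff)
  qed
  with u show ?thesis by blast
qed

section \<open>Gram matrices of Hermitian matrices of rank one\<close>

text \<open>The right side is the real Frobenius inner product of the rank-one Hermitian matrices
  with entries \<open>cj (x b) * x a\<close> and \<open>cj (y b) * y a\<close>; the two adjoint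
  rules regroup the factors.\<close>

lemma norm_mult_cj_sum:
  fixes x y :: "'b \<Rightarrow> 'a::{real_normed_div_algebra, real_inner}"
  shows "(norm (\<Sum>a\<in>J. x a * cj (y a)))\<^sup>2
    = (\<Sum>a\<in>J. \<Sum>b\<in>J. (cj (x b) * x a) \<bullet> (cj (y b) * y a))"
proof -
  have "(x a * cj (y a)) \<bullet> (x b * cj (y b)) = (cj (x b) * x a) \<bullet> (cj (y b) * y a)" for a b
    using inner_mult_left_cj[of "cj (x b)" "x a * cj (y a)" "cj (y b)"]
      inner_mult_right_cj[of "cj (x b) * x a" "cj (y a)" "cj (y b)"]
    by (simp add: mult.assoc)
  then show ?thesis
    by (simp add: inner_sum_left inner_sum_right flip: dot_square_norm) (rule sum.swap)
qed

lemma norm_sum_mult_cj_le: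
  fixes x y :: "'b \<Rightarrow> 'a::{real_normed_div_algebra, real_inner}"
  shows "(norm (\<Sum>a\<in>J. x a * cj (y a)))\<^sup>2 \<le> (\<Sum>a\<in>J. (norm (x a))\<^sup>2) * (\<Sum>a\<in>J. (norm (y a))\<^sup>2)"
proof -
  have "norm (\<Sum>a\<in>J. x a * cj (y a)) \<le> (\<Sum>a\<in>J. norm (x a) * norm (y a))"
    by (rule order_trans[OF norm_sum]) (simp add: norm_mult)
  then have "(norm (\<Sum>a\<in>J. x a * cj (y a)))\<^sup>2 \<le> (\<Sum>a\<in>J. norm (x a) * norm (y a))\<^sup>2"
    by (intro power_mono) auto
  also have "\<dots> \<le> (\<Sum>a\<in>J. (norm (x a))\<^sup>2) * (\<Sum>a\<in>J. (norm (y a))\<^sup>2)"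
    by (rule Cauchy_Schwarz_ineq_sum)
  finally show ?thesis .
qed

text \<open>
  This is $(\mathrm{tr}\, G)^2 \le \mathrm{rank}\, G \cdot \|G\|_F^2$ for the Gram matrix $G$ of
  the vectors \<open>y i\<close>.
\<close>

lemma gram_trace_le:
  fixes y :: "'i \<Rightarrow> 'c \<Rightarrow> real"
  assumes "finite J"
  shows "(\<Sum>i\<in>I. \<Sum>c\<in>J. (y i c)\<^sup>2)\<^sup>2
    \<le> card J * (\<Sum>i\<in>I. \<Sum>j\<in>I. (\<Sum>c\<in>J. y i c * y j c)\<^sup>2)"
proof -
  define T where "T c c' = (\<Sum>i\<in>I. y i c * y i c')" for c c'
  have "(\<Sum>i\<in>I. \<Sum>c\<in>J. (y i c)\<^sup>2) = (\<Sum>c\<in>J. T c c)"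
    unfolding T_def power2_eq_square by (rule sum.swap)
  then have "(\<Sum>i\<in>I. \<Sum>c\<in>J. (y i c)\<^sup>2)\<^sup>2 = (\<Sum>c\<in>J. 1 * T c c)\<^sup>2" by simp
  also have "\<dots> \<le> (\<Sum>c\<in>J. 1\<^sup>2) * (\<Sum>c\<in>J. (T c c)\<^sup>2)"
    by (rule Cauchy_Schwarz_ineq_sum)
  also have "\<dots> = card J * (\<Sum>c\<in>J. (T c c)\<^sup>2)" by simp
  also have "\<dots> \<le> card J * (\<Sum>c\<in>J. \<Sum>c'\<in>J. (T c c')\<^sup>2)"
  proof (intro mult_left_mono sum_mono)
    fix c assume "c \<in> J"
    then show "(T c c)\<^sup>2 \<le> (\<Sum>c'\<in>J. (T c c')\<^sup>2)"
      using assms by (intro member_le_sum) auto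
  qed simp
  also have "(\<Sum>c\<in>J. \<Sum>c'\<in>J. (T c c')\<^sup>2) = (\<Sum>i\<in>I. \<Sum>j\<in>I. (\<Sum>c\<in>J. y i c * y j c)\<^sup>2)"
  proof -
    have "(\<Sum>c\<in>J. \<Sum>c'\<in>J. (T c c')\<^sup>2)
        = (\<Sum>c\<in>J. \<Sum>c'\<in>J. \<Sum>i\<in>I. \<Sum>j\<in>I. (y i c * y j c) * (y i c' * y j c'))"
      unfolding T_def power2_eq_square sum_product
      by (intro sum.cong refl) (simp add: algebra_simps)
    also have "\<dots> = (\<Sum>c\<in>J. \<Sum>i\<in>I. \<Sum>c'\<in>J. \<Sum>j\<in>I. (y i c * y j c) * (y i c' * y j c'))"
      by (rule sum.cong[OF refl], rule sum.swap)
    also have "\<dots> = (\<Sum>i\<in>I. \<Sum>c\<in>J. \<Sum>j\<in>I. \<Sum>c'\<in>J. (y i c * y j c) * (y i c' * y j c'))"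
      by (subst sum.swap, intro sum.cong[OF refl], rule sum.swap)
    also have "\<dots> = (\<Sum>i\<in>I. \<Sum>j\<in>I. \<Sum>c\<in>J. \<Sum>c'\<in>J. (y i c * y j c) * (y i c' * y j c'))"
      by (intro sum.cong[OF refl], rule sum.swap)
    also have "\<dots> = (\<Sum>i\<in>I. \<Sum>j\<in>I. (\<Sum>c\<in>J. y i c * y j c)\<^sup>2)"
      unfolding power2_eq_square sum_product ..
    finally show ?thesis .
  qed
  finally show ?thesis .
qed

lemma sum_symmetric_square:
  fixes F :: "nat \<Rightarrow> nat \<Rightarrow> real"
  assumes "\<And>a b. F a b = F b a"
  shows "(\<Sum>a<k. \<Sum>b<k. F a b) = (\<Sum>a<k. F a a) + 2 * (\<Sum>b<k. \<Sum>a<b. F a b)"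
proof (induction k)
  case (Suc k)
  have "(\<Sum>a<Suc k. \<Sum>b<Suc k. F a b) = (\<Sum>a<k. \<Sum>b<k. F a b) + (\<Sum>a<k. F a k) + (\<Sum>b<k. F k b) + F k k"
    by (simp add: sum.distrib)
  also have "(\<Sum>b<k. F k b) = (\<Sum>a<k. F a k)" using assms by (intro sum.cong) auto
  finally show ?case using Suc by simp
qed simp

text \<open>
  The vectors \<open>y i\<close> in the proof are the coordinates of the Hermitian $k \times k$ matrix
  $\sqrt{w_i}\,(x_i x_i^* / |x_i|^2 - \mu I)$: real diagonal entries, and the entries above the
  diagonal scaled by $\sqrt 2$. The shift $\mu$ is chosen such that their inner products
  are $\sqrt{w_i w_j}\,(|\langle x_i, x_j\rangle|^2 / (|x_i|^2 |x_j|^2) - \tau)$.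
\<close>

lemma hermitian_gram_bound:
  fixes k :: nat and x :: "'i \<Rightarrow> nat \<Rightarrow> 'a::{real_normed_div_algebra, euclidean_space}"
    and w t :: "'i \<Rightarrow> real"
  defines "t \<equiv> \<lambda>i. \<Sum>a<k. (norm (x i a))\<^sup>2"
  assumes w: "\<And>i. 0 \<le> w i" "\<And>i. t i = 0 \<Longrightarrow> w i = 0" and \<tau>: "real k * \<tau> \<le> 1" and k: "0 < k"
  shows "((\<Sum>i\<in>I. w i) * (1 - \<tau>))\<^sup>2 \<le> (real k + real k * (real k - 1) / 2 * DIM('a)) *
    (\<Sum>i\<in>I. \<Sum>j\<in>I. w i * w j * ((norm (\<Sum>a<k. x i a * cj (x j a)))\<^sup>2 / (t i * t j) - \<tau>)\<^sup>2)"
proof -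
  \<comment> \<open>The smaller root of \<open>k * \<mu>\<^sup>2 - 2 * \<mu> + \<tau> = 0\<close>,
    real because \<open>k * \<tau> \<le> 1\<close>.\<close>
  define \<mu> where "\<mu> = (1 - sqrt (1 - k * \<tau>)) / k"
  have \<mu>: "k * \<mu>\<^sup>2 - 2 * \<mu> = - \<tau>"
  proof -
    have "k * (k * \<mu>\<^sup>2 - 2 * \<mu>) = (k * \<mu> - 1)\<^sup>2 - 1" by (simp add: power2_eq_square algebra_simps)
    also have "\<dots> = k * - \<tau>" using k \<tau> by (simp add: \<mu>_def)
    finally show ?thesis using k by (metis mult_left_cancel of_nat_0_less_iff less_irrefl)
  qed
  define \<phi> where "\<phi> i a b = cj (x i b) * x i a" for i a b
  define J where "J = {..<k} <+> (SIGMA b:{..<k}. {..<b} \<times> (Basis :: 'a set))"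
  define y where "y i c = sqrt (w i) * (case c of
      Inl a \<Rightarrow> (norm (x i a))\<^sup>2 / t i - \<mu>
    | Inr (b, a, e) \<Rightarrow> sqrt 2 * (\<phi> i a b \<bullet> e) / t i)" for i c
  have fin: "finite J" by (simp add: J_def)
  have card: "real (card J) = real k + real k * (real k - 1) / 2 * DIM('a)"
  proof -
    have "real (\<Sum>b<k. b) = real k * (real k - 1) / 2" by (induction k) (auto simp: field_simps)
    moreover have "real (card J) = real k + real (\<Sum>b<k. b) * DIM('a)"
      by (simp add: J_def card_Plus card_cartesian_product sum_distrib_right)
    ultimately show ?thesis by (simp only:)
  qed
  \<comment> \<open>Conjugation swaps the entries \<open>(a, b)\<close> and \<open>(b, a)\<close>
    and preserves inner products, so one triangle counted twice gives the whole off-diagonal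
    sum.\<close>
  have \<phi>_sym: "\<phi> i a b \<bullet> \<phi> j a b = \<phi> i b a \<bullet> \<phi> j b a" for i j a b
    using inner_cj_cj[of "\<phi> i a b" "\<phi> j a b"] by (simp add: \<phi>_def cj_mult)
  have prod: "(\<Sum>c\<in>J. y i c * y j c) = sqrt (w i) * sqrt (w j) *
      ((norm (\<Sum>a<k. x i a * cj (x j a)))\<^sup>2 / (t i * t j) - \<tau>)" if "t i \<noteq> 0" "t j \<noteq> 0" for i j
  proof -
    have pairs: "(\<Sum>c\<in>(SIGMA b:{..<k}. {..<b} \<times> (Basis :: 'a set)). G c)
        = (\<Sum>b<k. \<Sum>a<b. \<Sum>e\<in>Basis. G (b, a, e))" for G :: "nat \<times> nat \<times> 'a \<Rightarrow> real"
      by (simp add: sum.Sigma sum.cartesian_product)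
    have "(\<Sum>c\<in>J. y i c * y j c) = (\<Sum>a<k. y i (Inl a) * y j (Inl a))
       + (\<Sum>b<k. \<Sum>a<b. \<Sum>e\<in>Basis. y i (Inr (b, a, e)) * y j (Inr (b, a, e)))"
      unfolding J_def by (subst sum.Plus) (simp_all add: pairs)
    also have "\<dots> = sqrt (w i) * sqrt (w j) *
      ((\<Sum>a<k. ((norm (x i a))\<^sup>2 / t i - \<mu>) * ((norm (x j a))\<^sup>2 / t j - \<mu>)) +
       (\<Sum>b<k. \<Sum>a<b. \<Sum>e\<in>Basis. 2 * ((\<phi> i a b \<bullet> e) * (\<phi> j a b \<bullet> e)) / (t i * t j)))"
      unfolding distrib_left sum_distrib_left
      by (intro arg_cong2[where f = "(+)"] sum.cong refl) (simp_all add: y_def)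
    also have "(\<Sum>b<k. \<Sum>a<b. \<Sum>e\<in>Basis. 2 * ((\<phi> i a b \<bullet> e) * (\<phi> j a b \<bullet> e)) / (t i * t j))
        = 2 * (\<Sum>b<k. \<Sum>a<b. \<phi> i a b \<bullet> \<phi> j a b) / (t i * t j)"
    proof -
      have "\<phi> i a b \<bullet> \<phi> j a b = (\<Sum>e\<in>Basis. (\<phi> i a b \<bullet> e) * (\<phi> j a b \<bullet> e))" for a b
        by (rule euclidean_inner)
      then show ?thesis by (simp add: sum_distrib_left sum_divide_distrib)
    qed
    also have "(\<Sum>a<k. ((norm (x i a))\<^sup>2 / t i - \<mu>) * ((norm (x j a))\<^sup>2 / t j - \<mu>))
        = (\<Sum>a<k. (norm (x i a))\<^sup>2 * (norm (x j a))\<^sup>2) / (t i * t j)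
          - \<mu> * (t i / t i) - \<mu> * (t j / t j) + k * \<mu>\<^sup>2"
    proof -
      have "((norm (x i a))\<^sup>2 / t i - \<mu>) * ((norm (x j a))\<^sup>2 / t j - \<mu>)
          = (norm (x i a))\<^sup>2 * (norm (x j a))\<^sup>2 / (t i * t j)
            - \<mu> * ((norm (x i a))\<^sup>2 / t i) - \<mu> * ((norm (x j a))\<^sup>2 / t j) + \<mu>\<^sup>2" for a
        by (simp add: algebra_simps power2_eq_square)
      moreover have "(\<Sum>a<k. (norm (x i a))\<^sup>2) = t i" for i
        unfolding t_def ..
      ultimately show ?thesis
        by (simp only: sum.distrib sum_subtractf flip: sum_distrib_left sum_divide_distrib) simp
    qed
    also have "\<dots> = (\<Sum>a<k. \<phi> i a a \<bullet> \<phi> j a a) / (t i * t j) - \<tau>"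
    proof -
      have "\<phi> i a a \<bullet> \<phi> j a a = (norm (x i a))\<^sup>2 * (norm (x j a))\<^sup>2" for a
        by (simp add: \<phi>_def cj_mult_self inner_one_one)
      then show ?thesis using that \<mu> by simp
    qed
    also have "\<dots> + 2 * (\<Sum>b<k. \<Sum>a<b. \<phi> i a b \<bullet> \<phi> j a b) / (t i * t j)
       = (norm (\<Sum>a<k. x i a * cj (x j a)))\<^sup>2 / (t i * t j) - \<tau>"
      using sum_symmetric_square[of "\<lambda>a b. \<phi> i a b \<bullet> \<phi> j a b" k] \<phi>_sym
      by (simp add: norm_mult_cj_sum \<phi>_def[symmetric] add_divide_distrib)
    finally show ?thesis .
  qed
  \<comment> \<open>If \<open>t i = 0\<close>, the quotient takes the default value 0, but then
    \<open>w i = 0\<close> and both sides vanish.\<close>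
  have prod2: "(\<Sum>c\<in>J. y i c * y j c)\<^sup>2 = w i * w j *
      ((norm (\<Sum>a<k. x i a * cj (x j a)))\<^sup>2 / (t i * t j) - \<tau>)\<^sup>2" for i j
  proof (cases "t i = 0 \<or> t j = 0")
    case True
    then have "w i = 0 \<or> w j = 0" using w by blast
    then show ?thesis by (auto simp: y_def)
  next
    case False
    then show ?thesis using prod[of i j] w by (simp add: power_mult_distrib)
  qed
  have self: "(\<Sum>c\<in>J. (y i c)\<^sup>2) = w i * (1 - \<tau>)" for i
  proof (cases "t i = 0")
    case True
    then show ?thesis using w by (simp add: y_def)
  next
    case False
    have "(\<Sum>a<k. x i a * cj (x i a)) = t i *\<^sub>R 1"
      by (simp add: mult_cj_self t_def scaleR_left.sum)
    then have "norm (\<Sum>a<k. x i a * cj (x i a)) = t i"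
      by (simp add: t_def sum_nonneg)
    then show ?thesis using False prod[of i i] w by (simp add: power2_eq_square)
  qed
  show ?thesis
    using gram_trace_le[OF fin, where I = I and y = y] unfolding prod2 self card by (simp add: sum_distrib_right)
qed

section \<open>Real inequalities\<close>

text \<open>If \<open>f s < 0\<close>, the mean value theorem yields a point where
  \<open>f''\<close> is negative and a later one where it is at least 0. Here \<open>f\<close> will
  be the error of a quadratic interpolation, doubly at \<open>c\<close> and simply at
  \<open>b\<close>.\<close>

lemma nonneg_if_antimono_second_deriv:
  fixes f :: "real \<Rightarrow> real"
  assumes ab: "a < c" "c < b" and cont: "continuous_on {a..b} f"
    and f': "\<And>x. a < x \<Longrightarrow> x < b \<Longrightarrow> (f has_real_derivative f' x) (at x)"
    and f'': "\<And>x. a < x \<Longrightarrow> x < b \<Longrightarrow> (f' has_real_derivative f'' x) (at x)"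
    and anti: "\<And>x y. a < x \<Longrightarrow> x \<le> y \<Longrightarrow> y < b \<Longrightarrow> f'' y \<le> f'' x"
    and zero: "f c = 0" "f' c = 0" "f b = 0" and s: "a \<le> s" "s \<le> b"
  shows "0 \<le> f s"
proof (rule ccontr)
  assume neg: "\<not> 0 \<le> f s"
  have mvt: "\<exists>z. x < z \<and> z < y \<and> f y - f x = (y - x) * f' z" if "a \<le> x" "x < y" "y \<le> b" for x y
  proof -
    have "continuous_on {x..y} f" using cont by (rule continuous_on_subset) (use that in auto)
    moreover have "f differentiable (at w)" if "x < w" "w < y" for w
      using f'[of w] that \<open>a \<le> x\<close> \<open>y \<le> b\<close> by (auto intro: differentiableI simp: real_differentiable_def)
    ultimately obtain l z where "x < z" "z < y" "DERIV f z :> l" "f y - f x = (y - x) * l"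
      using MVT[OF \<open>x < y\<close>, of f] by blast
    moreover from this have "l = f' z" using f'[of z] that by (intro DERIV_unique) auto
    ultimately show ?thesis by blast
  qed
  have mvt': "\<exists>z. x < z \<and> z < y \<and> f' y - f' x = (y - x) * f'' z" if "a < x" "x < y" "y < b" for x y
    using MVT2[of x y f' f''] f'' that by auto
  consider "s < c" | "c < s" using neg zero by fastforce
  then show False
  proof cases
    case 1
    obtain z where z: "s < z" "z < c" "f c - f s = (c - s) * f' z" using mvt[of s c] 1 s ab by auto
    then have "0 < (c - s) * f' z" using neg zero by linarith
    then have "0 < f' z" using 1 by (simp add: zero_less_mult_iff)
    obtain x where x: "z < x" "x < c" "f' c - f' z = (c - z) * f'' x" using mvt'[of z c] z s ab by auto
    then have "(c - z) * f'' x < 0" using \<open>0 < f' z\<close> zero by linarith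
    then have "f'' x < 0" using z by (simp add: mult_less_0_iff)
    \<comment> \<open>Rolle for \<open>f\<close> on \<open>[c, b]\<close> and then for
      \<open>f'\<close> on \<open>[c, y]\<close> gives a zero of \<open>f''\<close> to the right of
      \<open>x\<close>.\<close>
    obtain y where y: "c < y" "y < b" "f' y = 0" using mvt[of c b] ab zero by auto
    obtain v where v: "c < v" "v < y" "f' y - f' c = (y - c) * f'' v" using mvt'[of c y] y ab by auto
    then have "f'' v = 0" using y zero by simp
    then show False using anti[of x v] x v z s y \<open>f'' x < 0\<close> by simp
  next
    case 2
    then have "s < b" using neg zero s by (cases "s = b") auto
    obtain z where z: "c < z" "z < s" "f s - f c = (s - c) * f' z" using mvt[of c s] 2 s ab by auto
    then have "(s - c) * f' z < 0" using neg zero by linarith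
    then have "f' z < 0" using 2 by (simp add: mult_less_0_iff)
    obtain y where y: "s < y" "y < b" "f b - f s = (b - s) * f' y"
      using mvt[of s b] \<open>s < b\<close> s 2 ab by auto
    then have "0 < (b - s) * f' y" using neg zero by linarith
    then have "0 < f' y" using \<open>s < b\<close> by (simp add: zero_less_mult_iff)
    obtain x where x: "c < x" "x < z" "f' z - f' c = (z - c) * f'' x"
      using mvt'[of c z] z s ab by auto
    then have "(z - c) * f'' x < 0" using \<open>f' z < 0\<close> zero by linarith
    then have "f'' x < 0" using z by (simp add: mult_less_0_iff)
    obtain v where v: "z < v" "v < y" "f' y - f' z = (y - z) * f'' v" using mvt'[of z y] z y ab by auto
    then have "0 < (y - z) * f'' v" using \<open>0 < f' y\<close> \<open>f' z < 0\<close> by linarith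
    then have "0 < f'' v" using y z by (simp add: zero_less_mult_iff)
    then show False using anti[of x v] x v z s y ab \<open>f'' x < 0\<close> by simp
  qed
qed

text \<open>\<open>L\<close> is chosen so that the quadratic, tangent to the power at \<tau>, has
  the value 1 at 1. The second derivative of the difference is decreasing since
  \<open>u * (1 - u) \<ge> 0\<close> and \<open>u - 2 < 0\<close>.\<close>

lemma powr_le_quadratic:
  fixes s \<tau> u :: real
  assumes \<tau>: "0 < \<tau>" "\<tau> < 1" and u: "0 < u" "u \<le> 1" and s: "0 \<le> s" "s \<le> 1"
  defines "L \<equiv> (\<tau> powr u + u * \<tau> powr (u - 1) * (1 - \<tau>) - 1) / (1 - \<tau>)\<^sup>2"
  shows "s powr u \<le> \<tau> powr u + u * \<tau> powr (u - 1) * (s - \<tau>) - L * (s - \<tau>)\<^sup>2"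
proof -
  define f where "f x = \<tau> powr u + u * \<tau> powr (u - 1) * (x - \<tau>) - L * (x - \<tau>)\<^sup>2 - x powr u" for x
  define f' where "f' x = u * \<tau> powr (u - 1) - 2 * L * (x - \<tau>) - u * x powr (u - 1)" for x
  define f'' where "f'' x = - 2 * L + u * (1 - u) * x powr (u - 2)" for x
  have "0 \<le> f s"
  proof (rule nonneg_if_antimono_second_deriv[of 0 \<tau> 1 f f' f''])
    show "continuous_on {0..1} f"
    proof -
      have "continuous_on {0..1} (\<lambda>x. x powr u)"
        using u by (intro continuous_on_powr' continuous_intros) auto
      then show ?thesis unfolding f_def
        by (rule continuous_on_diff[rotated]) (intro continuous_intros)
    qed
    show "(f has_real_derivative f' x) (at x)" if "0 < x" for x
      unfolding f_def f'_def using that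
      by (auto intro!: derivative_eq_intros simp: power2_eq_square)
    show "(f' has_real_derivative f'' x) (at x)" if "0 < x" for x
      unfolding f'_def f''_def using that
      by (auto intro!: derivative_eq_intros simp: algebra_simps)
    show "f'' y \<le> f'' x" if "0 < x" "x \<le> y" for x y
      unfolding f''_def using that u by (intro add_left_mono mult_left_mono powr_mono2') auto
    show "f \<tau> = 0" "f' \<tau> = 0" "f 1 = 0"
      using \<tau> by (simp_all add: f_def f'_def L_def)
  qed (use \<tau> s in auto)
  then show ?thesis by (simp add: f_def)
qed

section \<open>Power sums with a prescribed total, and Hoelder's inequality\<close>

text \<open>Weighted AM-GM for \<open>t / c\<close> and 1. At \<open>t = 0\<close> the left side is
  0 even for \<open>v = 0\<close>, since \<open>0 powr 0 = 0\<close>.\<close>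

lemma powr_le_tangent:
  fixes c t v :: real
  assumes "0 \<le> v" "v \<le> 1" "0 < c" "0 \<le> t"
  shows "t powr v \<le> c powr v * (1 + v * (t / c - 1))"
proof (cases "t = 0")
  case False
  then have "(t / c) powr v * 1 powr (1 - v) \<le> v * (t / c) + (1 - v) * 1"
    using assms by (intro Youngs_inequality_0) auto
  then have "c powr v * (t / c) powr v \<le> c powr v * (1 + v * (t / c - 1))"
    by (intro mult_left_mono) (auto simp: algebra_simps)
  then show ?thesis using assms by (simp add: powr_divide)
qed (use assms in simp)

text \<open>The tangent is taken at the mean \<open>K / CARD('n)\<close>, so the linear terms sum to
  zero.\<close>

lemma sum_powr_le:
  fixes t :: "'n::finite \<Rightarrow> real"
  assumes "0 \<le> v" "v \<le> 1" "0 < K" "\<And>i. 0 \<le> t i" "(\<Sum>i\<in>UNIV. t i) = K"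
  shows "(\<Sum>i\<in>UNIV. t i powr v) \<le> CARD('n) * (K / CARD('n)) powr v"
proof -
  define c where "c = K / CARD('n)"
  have c: "0 < c" using assms by (simp add: c_def)
  have "(\<Sum>i\<in>UNIV. t i powr v) \<le> (\<Sum>i\<in>UNIV. c powr v * (1 + v * (t i / c - 1)))"
    using assms c by (intro sum_mono powr_le_tangent) auto
  also have "\<dots> = c powr v * (CARD('n) + v * (K / c - CARD('n)))"
    using assms(5) by (simp add: sum.distrib sum_subtractf flip: sum_distrib_left sum_divide_distrib)
  also have "\<dots> = CARD('n) * c powr v" using assms by (simp add: c_def)
  finally show ?thesis by (simp add: c_def)
qed

text \<open>The convex tangent inequality is \<open>powr_le_tangent\<close> for the exponent
  \<open>1 / q\<close> at \<open>x powr q\<close>; again the tangent is taken at the mean.\<close>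

lemma sum_powr_ge:
  fixes t :: "'n::finite \<Rightarrow> real"
  assumes "1 \<le> q" "0 < K" "\<And>i. 0 \<le> t i" "(\<Sum>i\<in>UNIV. t i) = K"
  shows "CARD('n) * (K / CARD('n)) powr q \<le> (\<Sum>i\<in>UNIV. t i powr q)"
proof -
  define c where "c = K / CARD('n)"
  have c: "0 < c" using assms by (simp add: c_def)
  have tangent: "c powr q * (1 + q * (x / c - 1)) \<le> x powr q" if "0 \<le> x" for x
  proof -
    have "x = (x powr q) powr (1 / q)" using that assms by (simp add: powr_powr)
    also have "\<dots> \<le> (c powr q) powr (1 / q) * (1 + 1 / q * (x powr q / c powr q - 1))"
      using assms c by (intro powr_le_tangent) auto
    finally have "x \<le> c * (1 + 1 / q * (x powr q / c powr q - 1))"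
      using assms c by (simp add: powr_powr)
    then show ?thesis using c assms by (simp add: field_simps)
  qed
  have "CARD('n) * c powr q = c powr q * (CARD('n) + q * (K / c - CARD('n)))"
    using assms by (simp add: c_def)
  also have "\<dots> = (\<Sum>i\<in>UNIV. c powr q * (1 + q * (t i / c - 1)))"
    using assms(4) by (simp add: sum.distrib sum_subtractf flip: sum_distrib_left sum_divide_distrib)
  also have "\<dots> \<le> (\<Sum>i\<in>UNIV. t i powr q)"
    using assms by (intro sum_mono tangent)
  finally show ?thesis by (simp add: c_def)
qed

lemma Holder_sum:
  fixes a b :: "'i \<Rightarrow> real"
  assumes "1 < p" "1 < q" "1 / p + 1 / q = 1" and fin: "finite I"
    and "\<And>i. i \<in> I \<Longrightarrow> 0 \<le> a i" "\<And>i. i \<in> I \<Longrightarrow> 0 \<le> b i"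
  shows "(\<Sum>i\<in>I. a i * b i) \<le> (\<Sum>i\<in>I. a i powr p) powr (1 / p) * (\<Sum>i\<in>I. b i powr q) powr (1 / q)"
proof -
  define X Y where "X = (\<Sum>i\<in>I. a i powr p)" and "Y = (\<Sum>i\<in>I. b i powr q)"
  have XY: "0 \<le> X" "0 \<le> Y" by (auto simp: X_def Y_def sum_nonneg)
  show ?thesis
  proof (cases "X = 0 \<or> Y = 0")
    case True
    then have "\<forall>i\<in>I. a i * b i = 0"
      using fin by (auto simp: X_def Y_def sum_nonneg_eq_0_iff)
    then have "(\<Sum>i\<in>I. a i * b i) = 0" by (rule sum.neutral)
    then show ?thesis by simp
  next
    case False
    define x y where "x = X powr (1 / p)" and "y = Y powr (1 / q)"
    have pos: "0 < x" "0 < y" "x powr p = X" "y powr q = Y"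
      using False XY assms by (simp_all add: x_def y_def powr_powr)
    have "(\<Sum>i\<in>I. a i * b i) / (x * y) = (\<Sum>i\<in>I. (a i / x) * (b i / y))"
      by (simp add: sum_divide_distrib)
    also have "\<dots> \<le> (\<Sum>i\<in>I. (a i / x) powr p / p + (b i / y) powr q / q)"
      using assms pos by (intro sum_mono Youngs_inequality) auto
    also have "\<dots> = (\<Sum>i\<in>I. a i powr p) / X / p + (\<Sum>i\<in>I. b i powr q) / Y / q"
      using assms pos by (simp add: sum.distrib powr_divide sum_divide_distrib)
    also have "\<dots> = 1" using False assms(3) by (simp add: X_def[symmetric] Y_def[symmetric])
    finally show ?thesis using pos
      by (simp add: X_def[symmetric] Y_def[symmetric] x_def[symmetric] y_def[symmetric] field_simps)
  qed
qed

section \<open>Logarithmic estimates against the dimension\<close>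

text \<open>With \<open>y = sqrt z\<close> this says \<open>2 * ln y \<le> y - 1 / y\<close>:
  equality holds at 1, and the difference has derivative \<open>(1 - 1 / y)\<^sup>2\<close>.\<close>

lemma ln_le_sqrt:
  fixes z :: real
  assumes "1 \<le> z"
  shows "ln z \<le> (z - 1) / sqrt z"
proof -
  define g where "g y = y - 1 / y - 2 * ln y" for y :: real
  have "g 1 \<le> g (sqrt z)"
  proof (rule DERIV_nonneg_imp_nondecreasing[where f = g])
    fix y :: real assume y: "1 \<le> y" "y \<le> sqrt z"
    have "(g has_real_derivative (1 - 1 / y)\<^sup>2) (at y)"
      unfolding g_def using y
      by (auto intro!: derivative_eq_intros simp: field_simps power2_eq_square)
    then show "\<exists>D. (g has_real_derivative D) (at y) \<and> 0 \<le> D" by auto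
  qed (use assms in simp)
  then have "ln z \<le> sqrt z - 1 / sqrt z" using assms by (simp add: g_def ln_sqrt)
  also have "\<dots> = (z - 1) / sqrt z" using assms by (simp add: field_simps)
  finally show ?thesis .
qed

text \<open>This will make the coefficient of the squared weight sum nonnegative. Applying
  \<open>exp x \<ge> 1 + x\<close> to \<open>z powr u = z * exp (- ((1 - u) * ln z))\<close>
  extracts the factor \<open>1 - u\<close> and leaves a bound on
  \<open>z * ln z - (z - 1)\<close>.\<close>

lemma powr_lower_bound_dim:
  fixes k m :: nat and u :: real
  assumes k: "2 \<le> k" and m: "1 \<le> m" and u: "u \<le> 1"
  defines "z \<equiv> real k + 2 / m"
  shows "1 + u * (z - 1) - z powr u \<le> (1 - u) * (real k + real k * (real k - 1) / 2 * m)"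
proof -
  have z: "2 < z"
  proof -
    have "0 < 2 / real m" "2 \<le> real k" using k m by auto
    then show ?thesis unfolding z_def by linarith
  qed
  have "z * (1 - (1 - u) * ln z) \<le> z * exp (- ((1 - u) * ln z))"
    using z exp_ge_add_one_self[of "- ((1 - u) * ln z)"] by (intro mult_left_mono) auto
  also have "\<dots> = z powr u"
    using z by (simp add: powr_def algebra_simps flip: exp_add) (simp add: exp_diff field_simps)
  finally have 1: "1 + u * (z - 1) - z powr u \<le> (1 - u) * (z * ln z - (z - 1))"
    by (simp add: algebra_simps)
  have 2: "z * ln z - (z - 1) \<le> real k + real k * (real k - 1) / 2 * m"
  \<comment> \<open>For \<open>m = 1\<close> the right side equals
    \<open>(z - 1) * (z - 2) / 2\<close>, which calls for \<open>ln_le_sqrt\<close>; for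
    \<open>m \<ge> 2\<close> it is at least \<open>k\<^sup>2\<close>, while
    \<open>z - 1 \<le> k\<close>, and \<open>ln z \<le> z - 1\<close> suffices.\<close>
  proof (cases "m = 1")
    case True
    have "2 \<le> sqrt z" using True k by (intro real_le_rsqrt) (simp add: z_def)
    have "z * ln z \<le> z * ((z - 1) / sqrt z)" using z ln_le_sqrt[of z] by (intro mult_left_mono) auto
    also have "\<dots> = (z - 1) * sqrt z"
      using z by (simp add: real_div_sqrt field_simps)
    finally have "z * ln z - (z - 1) \<le> (z - 1) * (sqrt z - 1)" by (simp add: algebra_simps)
    also have "2 * sqrt z \<le> sqrt z * sqrt z" using \<open>2 \<le> sqrt z\<close> z by (intro mult_right_mono) auto
    then have "2 * sqrt z \<le> z" using z by simp
    then have "(z - 1) * (sqrt z - 1) \<le> (z - 1) * ((z - 2) / 2)" using z by (intro mult_left_mono) auto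
    also have "\<dots> = real k + real k * (real k - 1) / 2 * m"
      using True by (simp add: z_def field_simps)
    finally show ?thesis .
  next
    case False
    then have m2: "2 \<le> real m" using m by linarith
    then have "z - 1 \<le> real k" using m by (simp add: z_def field_simps)
    have "z * ln z \<le> z * (z - 1)" using z ln_le_minus_one[of z] by simp
    then have "z * ln z - (z - 1) \<le> (z - 1) * (z - 1)" by (simp add: algebra_simps)
    also have "\<dots> \<le> real k * real k" using \<open>z - 1 \<le> real k\<close> z by (intro mult_mono) auto
    also have "\<dots> = real k + real k * (real k - 1) / 2 * 2" by (simp add: field_simps)
    also have "\<dots> \<le> real k + real k * (real k - 1) / 2 * m"
      using m2 k by (intro add_left_mono mult_left_mono) auto
    finally show ?thesis .
  qed
  show ?thesis using 1 mult_left_mono[OF 2, of "1 - u"] u by linarith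
qed

section \<open>The energy of a tight frame\<close>

text \<open>
  With weights \<open>t i powr u\<close> and $s_{ij} = S_{ij} / (t_i t_j)$ the summand is
  $w_i w_j s_{ij}^u$. The quadratic interpolating $s^u$ at $\tau$ (doubly) and at $1$
  bounds it from above; the coefficients that result for $(\sum_i w_i)^2$ and for
  $\sum_{ij} w_i w_j s_{ij}$ are nonnegative, and both sums are largest when all $t_i$
  are equal.
\<close>

lemma frame_energy_le:
  fixes S :: "'n::finite \<Rightarrow> 'n \<Rightarrow> real" and k m :: nat
  assumes S: "\<And>i j. 0 \<le> S i j" "\<And>i j. S i j \<le> t i * t j" "\<And>i j. S i j = S j i"
    and row: "\<And>i. (\<Sum>j\<in>UNIV. S i j) = t i" and total: "(\<Sum>i\<in>UNIV. t i) = real k"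
    and k: "1 \<le> k" and m: "1 \<le> m" and u: "1 / 2 < u" "u \<le> 1"
    and \<tau>_def: "\<tau> = 1 / (real k + 2 / m)" and M_def: "M = real k + real k * (real k - 1) / 2 * m"
    and var: "((\<Sum>i\<in>UNIV. t i powr u) * (1 - \<tau>))\<^sup>2
      \<le> M * (\<Sum>i\<in>UNIV. \<Sum>j\<in>UNIV. t i powr u * t j powr u * (S i j / (t i * t j) - \<tau>)\<^sup>2)"
  shows "(\<Sum>i\<in>UNIV. \<Sum>j\<in>UNIV. S i j powr u)
    \<le> (CARD('n))\<^sup>2 * (k / CARD('n)) powr (2 * u) * (\<tau> powr u + 1 / M * (1 - \<tau> powr u))"
proof -
  define N where "N = real CARD('n)"
  define w where "w i = t i powr u" for i
  define s where "s i j = S i j / (t i * t j)" for i j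
  define W where "W = (\<Sum>i\<in>UNIV. w i)"
  define E where "E = (\<Sum>i\<in>UNIV. \<Sum>j\<in>UNIV. w i * w j * s i j)"
  have t: "0 \<le> t i" for i using row[of i] S(1) by (metis sum_nonneg)
  have w: "0 \<le> w i" for i by (simp add: w_def)
  have N: "0 < N" by (simp add: N_def)
  have s: "0 \<le> s i j" "s i j \<le> 1" for i j
  proof -
    show "0 \<le> s i j" using S(1) t by (simp add: s_def)
    have "0 \<le> t i * t j" using t by simp
    then show "s i j \<le> 1" using S(2)[of i j] unfolding s_def divide_le_eq_1 by linarith
  qed
  have S0: "S i j = 0" if "t i = 0 \<or> t j = 0" for i j
    using S(1,2)[of i j] that by auto
  have Su: "S i j powr u = w i * w j * s i j powr u" for i j
    using S0[of i j] t[of i] t[of j] S(1)[of i j]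
    by (cases "t i = 0 \<or> t j = 0") (auto simp: w_def s_def powr_divide powr_mult)
  have WW: "(\<Sum>i\<in>UNIV. \<Sum>j\<in>UNIV. w i * w j) = W\<^sup>2"
    by (simp add: W_def power2_eq_square sum_product)
  have "W \<le> N * (k / N) powr u"
    unfolding W_def w_def N_def using u t total k by (intro sum_powr_le) auto
  moreover have "0 \<le> W" by (simp add: W_def w sum_nonneg)
  ultimately have "W\<^sup>2 \<le> (N * (k / N) powr u)\<^sup>2" by (rule power_mono)
  also have "\<dots> = N\<^sup>2 * (k / N) powr (2 * u)"
    by (simp add: power2_eq_square mult_ac flip: powr_add)
  finally have W2: "W\<^sup>2 \<le> N\<^sup>2 * (k / N) powr (2 * u)" .
  have T: "(\<Sum>i\<in>UNIV. \<Sum>j\<in>UNIV. S i j powr u) = (\<Sum>i\<in>UNIV. \<Sum>j\<in>UNIV. w i * w j * s i j powr u)"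
    by (simp add: Su)
  show ?thesis
  \<comment> \<open>For \<open>k = 1\<close> one has \<open>M = 1\<close>, the last factor is 1, and
    \<open>s i j \<le> 1\<close> suffices.\<close>
  proof (cases "k = 1")
    case True
    have "(\<Sum>i\<in>UNIV. \<Sum>j\<in>UNIV. S i j powr u) \<le> (\<Sum>i\<in>UNIV. \<Sum>j\<in>UNIV. w i * w j)"
      unfolding T using w s u by (intro sum_mono mult_left_le powr_le1) auto
    then show ?thesis using WW W2 True by (simp add: N_def M_def)
  next
    case False
    define z where "z = real k + 2 / m"
    have k2: "2 \<le> k" using False k by simp
    have z: "1 < z"
    proof -
      have "0 < 2 / real m" "2 \<le> real k" using k2 m by auto
      then show ?thesis unfolding z_def by linarith
    qed
    have \<tau>: "\<tau> = 1 / z" "0 < \<tau>" "\<tau> < 1" using z by (simp_all add: \<tau>_def z_def[symmetric])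
    have "0 < real k * (real k - 1) / 2 * m" using k2 m by simp
    then have M: "0 < M" unfolding M_def by simp
    \<comment> \<open>\<open>c / (1 - \<tau>)\<^sup>2\<close> is the constant \<open>L\<close> of
      \<open>powr_le_quadratic\<close>.\<close>
    define c where "c = \<tau> powr u + u * \<tau> powr (u - 1) * (1 - \<tau>) - 1"
    have \<tau>u: "\<tau> powr (u - 1) * \<tau> = \<tau> powr u" using \<tau> by (simp add: powr_diff)
    have c_eq: "c = \<tau> powr u * (1 + u * (z - 1)) - 1"
    proof -
      have "\<tau> powr (u - 1) = \<tau> powr u * z" using \<tau>(2) by (simp add: powr_diff \<tau>(1))
      moreover have "z * (1 - \<tau>) = z - 1" using z by (simp add: \<tau>(1) field_simps)
      ultimately show ?thesis unfolding c_def by (simp add: distrib_left mult.assoc mult.left_commute)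
    qed
    \<comment> \<open>The tangent at \<tau> lies above the power at 1. The sign matters because
      \<open>V\<close> enters with the factor \<open>- c\<close> and is bounded from below.\<close>
    have c0: "0 \<le> c"
      using powr_le_tangent[of u \<tau> 1] \<tau>(2) u unfolding c_eq by (simp add: \<tau>(1))
    have c_le: "c \<le> \<tau> powr u * (1 - u) * M"
    proof -
      have "\<tau> powr u * z powr u = 1" using z by (simp add: \<tau>(1) flip: powr_mult)
      then have "c = \<tau> powr u * (1 + u * (z - 1) - z powr u)"
        unfolding c_eq by (simp add: right_diff_distrib)
      also have "\<dots> \<le> \<tau> powr u * ((1 - u) * M)"
        unfolding M_def z_def using k2 m u by (intro mult_left_mono powr_lower_bound_dim) auto
      finally show ?thesis by (simp add: mult.assoc)
    qed
    define V where "V = (\<Sum>i\<in>UNIV. \<Sum>j\<in>UNIV. w i * w j * (s i j - \<tau>)\<^sup>2)"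
    have V: "W\<^sup>2 / M \<le> V / (1 - \<tau>)\<^sup>2"
    proof -
      have "W\<^sup>2 * (1 - \<tau>)\<^sup>2 \<le> M * V"
        using var unfolding V_def W_def w_def s_def power_mult_distrib .
      moreover have "0 < (1 - \<tau>)\<^sup>2" using \<tau>(3) by simp
      ultimately show ?thesis using M
        by (simp add: pos_divide_le_eq pos_le_divide_eq mult.commute)
    qed
    have "(\<Sum>i\<in>UNIV. \<Sum>j\<in>UNIV. S i j powr u) \<le> (\<Sum>i\<in>UNIV. \<Sum>j\<in>UNIV. w i * w j *
      (\<tau> powr u + u * \<tau> powr (u - 1) * (s i j - \<tau>) - c / (1 - \<tau>)\<^sup>2 * (s i j - \<tau>)\<^sup>2))"
      unfolding T c_def using w s u \<tau> by (intro sum_mono mult_left_mono powr_le_quadratic) auto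
    also have "\<dots> = (\<Sum>i\<in>UNIV. \<Sum>j\<in>UNIV. \<tau> powr u * (1 - u) * (w i * w j)
      + u * \<tau> powr (u - 1) * (w i * w j * s i j) - c / (1 - \<tau>)\<^sup>2 * (w i * w j * (s i j - \<tau>)\<^sup>2))"
      by (intro sum.cong refl) (simp add: algebra_simps flip: \<tau>u)
    also have "\<dots> = \<tau> powr u * (1 - u) * W\<^sup>2 + u * \<tau> powr (u - 1) * E - c / (1 - \<tau>)\<^sup>2 * V"
      by (simp only: WW[symmetric] E_def V_def sum.distrib sum_subtractf sum_distrib_left)
    also have "\<dots> \<le> \<tau> powr u * (1 - u) * W\<^sup>2 + u * \<tau> powr (u - 1) * E - c * (W\<^sup>2 / M)"
      using mult_left_mono[OF V c0] by simp
    also have "\<dots> = (\<tau> powr u * (1 - u) - c / M) * W\<^sup>2 + u * \<tau> powr (u - 1) * E"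
      by (simp add: algebra_simps)
    also have "\<dots> \<le> (\<tau> powr u * (1 - u) - c / M) * (N\<^sup>2 * (k / N) powr (2 * u))
      + u * \<tau> powr (u - 1) * (N\<^sup>2 * (k / N) powr (2 * u) / k)"
    proof (intro add_mono mult_left_mono W2)
      show "0 \<le> \<tau> powr u * (1 - u) - c / M" using c_le M by (simp add: field_simps)
      \<comment> \<open>AM-GM separates the weights; summing rows leaves
        \<open>t i powr (2 * u - 1)\<close>, with an exponent between 0 and 1 to which
        \<open>sum_powr_le\<close> applies.\<close>
      have "E \<le> (\<Sum>i\<in>UNIV. \<Sum>j\<in>UNIV. (t i powr (2 * u - 2) * S i j + t j powr (2 * u - 2) * S i j) / 2)"
        unfolding E_def
      proof (intro sum_mono)
        fix i j
        show "w i * w j * s i j \<le> (t i powr (2 * u - 2) * S i j + t j powr (2 * u - 2) * S i j) / 2"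
        proof (cases "t i = 0 \<or> t j = 0")
          case True
          then show ?thesis using S0[of i j] by (simp add: s_def)
        next
          case False
          define x y where "x = t i powr (u - 1)" and "y = t j powr (u - 1)"
          have "w i * w j * s i j = x * y * S i j"
            using False t[of i] t[of j] by (simp add: w_def s_def x_def y_def powr_diff)
          also have "\<dots> \<le> (x\<^sup>2 + y\<^sup>2) / 2 * S i j"
            using S(1) sum_squares_bound[of x y] by (intro mult_right_mono) auto
          also have "x\<^sup>2 = t i powr (2 * u - 2)" by (simp add: x_def power2_eq_square flip: powr_add)
          also have "y\<^sup>2 = t j powr (2 * u - 2)" by (simp add: y_def power2_eq_square flip: powr_add)
          finally show ?thesis by (simp add: algebra_simps)
        qed
      qed
      also have "\<dots> = ((\<Sum>i\<in>UNIV. \<Sum>j\<in>UNIV. t i powr (2 * u - 2) * S i j) + (\<Sum>i\<in>UNIV. \<Sum>j\<in>UNIV. t j powr (2 * u - 2) * S i j)) / 2"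
        by (simp add: sum.distrib flip: sum_divide_distrib)
      also have "(\<Sum>i\<in>UNIV. \<Sum>j\<in>UNIV. t j powr (2 * u - 2) * S i j) = (\<Sum>i\<in>UNIV. \<Sum>j\<in>UNIV. t i powr (2 * u - 2) * S i j)"
        by (subst sum.swap) (simp add: S(3))
      also have "(\<Sum>i\<in>UNIV. \<Sum>j\<in>UNIV. t i powr (2 * u - 2) * S i j) = (\<Sum>i\<in>UNIV. t i powr (2 * u - 1))"
      proof (intro sum.cong refl)
        fix i
        have "(\<Sum>j\<in>UNIV. t i powr (2 * u - 2) * S i j) = t i powr (2 * u - 2) * t i"
          by (simp add: row flip: sum_distrib_left)
        also have "\<dots> = t i powr (2 * u - 1)"
          using t[of i] powr_add[of "t i" "2 * u - 2" 1] by (cases "t i = 0") auto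
        finally show "(\<Sum>j\<in>UNIV. t i powr (2 * u - 2) * S i j) = t i powr (2 * u - 1)" .
      qed
      also have "(\<dots> + \<dots>) / 2 = \<dots>" by simp
      also have "\<dots> \<le> N * (k / N) powr (2 * u - 1)"
        unfolding N_def using u t total k by (intro sum_powr_le) auto
      also have "\<dots> = N\<^sup>2 * (k / N) powr (2 * u) / k"
        using N k by (simp add: powr_diff power2_eq_square)
      finally show "E \<le> N\<^sup>2 * (k / N) powr (2 * u) / k" .
    qed (use u in simp)
    also have "\<dots> = N\<^sup>2 * (k / N) powr (2 * u)
        * (\<tau> powr u * (1 - u) - c / M + u * \<tau> powr (u - 1) / k)"
      by (simp add: algebra_simps)
    also have "\<tau> powr u * (1 - u) - c / M + u * \<tau> powr (u - 1) / k = \<tau> powr u + 1 / M * (1 - \<tau> powr u)"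
    proof -
      have "z * m = real k * m + 2" using m by (simp add: z_def field_simps)
      moreover have "0 < z" using z by simp
      \<comment> \<open>The property that singles out \<tau>: \<open>1 / k\<close> is the average of
        one 1 and \<open>M - 1\<close> copies of \<tau>, as for \<open>M\<close> equiangular lines
        forming a tight frame. It removes the term carrying the factor \<open>u\<close>.\<close>
      ultimately have "M * (1 / k - \<tau>) = 1 - \<tau>"
        using k2 m unfolding \<tau>(1) M_def by (simp add: field_simps)
      then have *: "1 / k - \<tau> = (1 - \<tau>) / M" using M by (simp add: field_simps)
      have "\<tau> powr u * (1 - u) - c / M + u * \<tau> powr (u - 1) / k
          = \<tau> powr u + (1 - \<tau> powr u) / M + u * \<tau> powr (u - 1) * (1 / k - \<tau> - (1 - \<tau>) / M)"
        unfolding c_def \<tau>u[symmetric] by (simp add: field_simps add_divide_distrib diff_divide_distrib)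
      then show ?thesis unfolding * by simp
    qed
    finally show ?thesis by (simp add: N_def)
  qed
qed

section \<open>The lower bound for matrices\<close>

text \<open>The class constraints cover the three algebras at once. In
  \<open>k \<le> P * T powr (1 / q)\<close> and \<open>T \<le> (k / N) powr q * X\<close> the factor
  \<open>k\<close> cancels, leaving \<open>N \<le> P * X powr (1 / q)\<close>.\<close>

lemma coh_bound_le_off_diagonal_norm:
  fixes A :: "'a::{real_normed_div_algebra, euclidean_space} ^ 'n ^ 'n"
  assumes d: "1 \<le> d" "d < CARD('n)" and p: "2 \<le> p"
    and rank: "right_rank A = d" and diag: "\<And>i. A $ i $ i = 1"
  shows "coh_bound DIM('a) CARD('n) d p
    \<le> (\<Sum>(i, j) \<in> {(i, j). i \<noteq> j}. norm (A $ i $ j) powr p) powr (1 / p)"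
proof -
  define k where "k = CARD('n) - d"
  define m where "m = DIM('a)"
  define N where "N = real CARD('n)"
  define q where "q = p / (p - 1)"
  \<comment> \<open>The exponent is halved because the energy estimate is about squared moduli;
    \<open>p \<ge> 2\<close> gives \<open>u \<le> 1\<close>. The next constant \<tau> is the square
    of \<open>coh_beta\<close>.\<close>
  define u where "u = q / 2"
  define \<tau> where "\<tau> = 1 / (real k + 2 / m)"
  define M where "M = real k + real k * (real k - 1) / 2 * m"
  have k: "1 \<le> k" and kd: "real k = N - real d" using d by (auto simp: k_def N_def of_nat_diff)
  have m: "1 \<le> m" using DIM_positive[where 'a = 'a] unfolding m_def by linarith
  have N: "0 < N" by (simp add: N_def)
  have q: "1 < q" "q \<le> 2" "1 / p + 1 / q = 1" "1 / q = 1 - 1 / p"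
    using p by (auto simp: q_def field_simps)
  have u: "1 / 2 < u" "u \<le> 1" using q by (auto simp: u_def)
  obtain v :: "nat \<Rightarrow> 'a ^ 'n" where v: "\<And>a. a < k \<Longrightarrow> norm (v a) = 1"
      "\<And>a b. a < k \<Longrightarrow> b < k \<Longrightarrow> a \<noteq> b \<Longrightarrow> hinner (v a) (v b) = 0" "\<And>a. a < k \<Longrightarrow> A *v v a = 0"
    using exists_orthonormal_kernel[of A d k] rank d by (auto simp: k_def)
  \<comment> \<open>The orthogonal projection onto the span of the \<open>v a\<close>;
    \<open>t\<close> is its diagonal.\<close>
  define C where "C i j = (\<Sum>a<k. v a $ i * cj (v a $ j))" for i j
  define t where "t i = (\<Sum>a<k. (norm (v a $ i))\<^sup>2)" for i
  have t: "0 \<le> t i" for i by (simp add: t_def sum_nonneg)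
  have C_diag: "C i i = t i *\<^sub>R 1" for i
    by (simp add: C_def t_def mult_cj_self scaleR_left.sum)
  have C_sym: "norm (C j i) = norm (C i j)" for i j
  proof -
    have "C j i = cj (C i j)" by (simp add: C_def cj_sum cj_mult)
    then show ?thesis by simp
  qed
  have total: "(\<Sum>i\<in>UNIV. t i) = real k"
  proof -
    have "(\<Sum>i\<in>UNIV. t i) = (\<Sum>a<k. (norm (v a))\<^sup>2)"
      unfolding t_def by (subst sum.swap) (simp add: norm_vec_def L2_set_def sum_nonneg)
    then show ?thesis using v(1) by simp
  qed
  \<comment> \<open>A diagonal entry of the identity saying that the Hermitian matrix
    \<open>C\<close> is idempotent; orthonormality leaves only the terms with
    \<open>a = b\<close>.\<close>
  have row: "(\<Sum>j\<in>UNIV. (norm (C i j))\<^sup>2) = t i" for i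
  proof -
    have ip: "(v a $ i * cj (v a $ j)) \<bullet> (v b $ i * cj (v b $ j))
        = v a $ i \<bullet> (v b $ i * (cj (v b $ j) * v a $ j))" for a b j
      by (simp add: inner_mult_right_cj[of "v a $ i"] mult.assoc)
    have "(\<Sum>j\<in>UNIV. (norm (C i j))\<^sup>2)
        = (\<Sum>j\<in>UNIV. \<Sum>b<k. \<Sum>a<k. v a $ i \<bullet> (v b $ i * (cj (v b $ j) * v a $ j)))"
      unfolding C_def dot_square_norm[symmetric] inner_sum_left inner_sum_right ip ..
    also have "\<dots> = (\<Sum>b<k. \<Sum>a<k. \<Sum>j\<in>UNIV. v a $ i \<bullet> (v b $ i * (cj (v b $ j) * v a $ j)))"
      by (subst sum.swap, rule sum.cong[OF refl], rule sum.swap)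
    also have "\<dots> = (\<Sum>b<k. \<Sum>a<k. v a $ i \<bullet> (v b $ i * hinner (v b) (v a)))"
      by (simp add: hinner_def inner_sum_right sum_distrib_left)
    also have "\<dots> = (\<Sum>b<k. \<Sum>a<k. if a = b then (norm (v b $ i))\<^sup>2 else 0)"
      by (intro sum.cong refl) (auto simp: v hinner_self dot_square_norm)
    also have "\<dots> = t i" by (simp add: t_def)
    finally show ?thesis .
  qed
  define X where "X = N\<^sup>2 * (\<tau> powr u + 1 / M * (1 - \<tau> powr u)) - N"
  define T where "T = (\<Sum>(i, j) \<in> {(i, j). i \<noteq> j}. norm (C j i) powr q)"
  define P where "P = (\<Sum>(i, j) \<in> {(i, j). i \<noteq> j}. norm (A $ i $ j) powr p) powr (1 / p)"
  have split: "(\<Sum>i\<in>UNIV. \<Sum>j\<in>UNIV. F i j) = (\<Sum>i\<in>UNIV. F i i) + (\<Sum>(i, j) \<in> {(i, j). i \<noteq> j}. F i j)"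
    for F :: "'n \<Rightarrow> 'n \<Rightarrow> 'b::comm_monoid_add"
  proof -
    have "(\<Sum>i\<in>UNIV. \<Sum>j\<in>UNIV. F i j) = (\<Sum>(i, j) \<in> range (\<lambda>i. (i, i)) \<union> {(i, j). i \<noteq> j}. F i j)"
      unfolding sum.cartesian_product by (rule sum.cong) auto
    also have "\<dots> = (\<Sum>(i, j) \<in> range (\<lambda>i. (i, i)). F i j) + (\<Sum>(i, j) \<in> {(i, j). i \<noteq> j}. F i j)"
      by (rule sum.union_disjoint) auto
    also have "(\<Sum>(i, j) \<in> range (\<lambda>i. (i, i)). F i j) = (\<Sum>i\<in>UNIV. F i i)"
      by (subst sum.reindex) (auto simp: inj_on_def)
    finally show ?thesis .
  qed
  have kP: "real k \<le> P * T powr (1 / q)"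
  proof -
    have "(\<Sum>i\<in>UNIV. \<Sum>j\<in>UNIV. A $ i $ j * C j i) = (\<Sum>i\<in>UNIV. \<Sum>a<k. (A *v v a) $ i * cj (v a $ i))"
      unfolding C_def matrix_vector_mult_def vec_lambda_beta sum_distrib_left sum_distrib_right mult.assoc
      by (rule sum.cong[OF refl], rule sum.swap)
    also have "\<dots> = 0" by (simp add: v)
    finally have "(\<Sum>i\<in>UNIV. C i i) = - (\<Sum>(i, j) \<in> {(i, j). i \<noteq> j}. A $ i $ j * C j i)"
      unfolding split by (simp add: diag eq_neg_iff_add_eq_0)
    moreover have "(\<Sum>i\<in>UNIV. C i i) = real k *\<^sub>R 1"
      by (simp add: C_diag flip: total scaleR_left.sum)
    ultimately have "real k *\<^sub>R 1 = - (\<Sum>(i, j) \<in> {(i, j). i \<noteq> j}. A $ i $ j * C j i)"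
      by simp
    from arg_cong[OF this, of norm]
    have "real k = norm (\<Sum>(i, j) \<in> {(i, j). i \<noteq> j}. A $ i $ j * C j i)" by simp
    also have "\<dots> \<le> (\<Sum>e \<in> {(i, j). i \<noteq> j}. norm (A $ fst e $ snd e) * norm (C (snd e) (fst e)))"
      by (rule order_trans[OF norm_sum]) (simp add: norm_mult case_prod_beta)
    also have "\<dots> \<le> P * T powr (1 / q)"
      unfolding P_def T_def case_prod_beta using q p by (intro Holder_sum) auto
    finally show ?thesis .
  qed
  have T_le: "T \<le> (k / N) powr q * X"
  proof -
    have var: "((\<Sum>i\<in>UNIV. t i powr u) * (1 - \<tau>))\<^sup>2 \<le> M * (\<Sum>i\<in>UNIV. \<Sum>j\<in>UNIV. t i powr u * t j powr u *
        ((norm (C i j))\<^sup>2 / (t i * t j) - \<tau>)\<^sup>2)"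
      unfolding M_def m_def C_def t_def
    proof (rule hermitian_gram_bound)
      show "real k * \<tau> \<le> 1" using k m by (simp add: \<tau>_def divide_le_eq add_pos_pos)
    qed (use k in auto)
    have energy: "(\<Sum>i\<in>UNIV. \<Sum>j\<in>UNIV. (norm (C i j))\<^sup>2 powr u)
        \<le> (CARD('n))\<^sup>2 * (k / CARD('n)) powr (2 * u) * (\<tau> powr u + 1 / M * (1 - \<tau> powr u))"
    proof (rule frame_energy_le[OF _ _ _ row total k m u \<tau>_def M_def var])
      show "(norm (C i j))\<^sup>2 \<le> t i * t j" for i j
        unfolding C_def t_def by (rule norm_sum_mult_cj_le)
    qed (simp_all add: C_sym)
    have pw: "(norm (C i j))\<^sup>2 powr u = norm (C j i) powr q" for i j
      unfolding u_def C_sym[of i j]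
      by (cases "C i j = 0") (simp_all add: powr_powr flip: powr_numeral)
    \<comment> \<open>The energy includes the diagonal, whose part is at least
      \<open>N * (k / N) powr q\<close> by convexity; this accounts for the \<open>- N\<close> in
      \<open>X\<close>.\<close>
    have "(\<Sum>i\<in>UNIV. t i powr q) + T \<le> (k / N) powr q * (X + N)"
      using energy unfolding pw split T_def by (simp add: C_diag t X_def N_def u_def mult_ac)
    moreover have "N * (k / N) powr q \<le> (\<Sum>i\<in>UNIV. t i powr q)"
      unfolding N_def using q k t total by (intro sum_powr_ge) auto
    ultimately show ?thesis by (simp add: algebra_simps)
  qed
  have T0: "0 \<le> T" by (auto simp: T_def intro: sum_nonneg)
  \<comment> \<open>Since \<open>T\<close> is nonnegative, its upper bound forces
    \<open>X \<ge> 0\<close>; the case \<open>X = 0\<close>, where the final division would fail, is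
    excluded below by \<open>N > 0\<close>.\<close>
  have "0 \<le> X"
  proof -
    have "0 < (k / N) powr q" using k N by simp
    moreover have "0 \<le> (k / N) powr q * X" using T0 T_le by linarith
    ultimately show ?thesis by (simp add: zero_le_mult_iff)
  qed
  have P0: "0 \<le> P" by (simp add: P_def)
  have "T powr (1 / q) \<le> ((k / N) powr q * X) powr (1 / q)"
    using q(1) T0 T_le by (intro powr_mono2) auto
  with kP have "real k \<le> P * ((k / N) powr q * X) powr (1 / q)"
    by (rule order_trans[OF _ mult_left_mono[OF _ P0]])
  also have "((k / N) powr q * X) powr (1 / q) = k / N * X powr (1 / q)"
    using q(1) N \<open>0 \<le> X\<close> by (simp add: powr_mult powr_powr)
  finally have "N * 1 \<le> P * X powr (1 / q)" using k N by (simp add: field_simps)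
  moreover from this have "0 < X powr (1 / q)" using N by (cases "X = 0") auto
  ultimately have "N / X powr (1 / q) \<le> P" by (simp add: divide_le_eq)
  moreover have "coh_bound DIM('a) CARD('n) d p = N / X powr (1 / q)"
  proof -
    have "coh_beta DIM('a) CARD('n) d powr (p / (p - 1)) = \<tau> powr u"
    proof -
      have "coh_beta DIM('a) CARD('n) d = sqrt \<tau>"
        by (simp only: coh_beta_def \<tau>_def kd N_def m_def divide_inverse)
      also have "\<dots> = \<tau> powr (1 / 2)" by (simp add: \<tau>_def powr_half_sqrt)
      finally show ?thesis by (simp add: powr_powr u_def q_def mult.commute)
    qed
    moreover have "coh_M DIM('a) CARD('n) d = M"
      by (simp add: coh_M_def M_def kd N_def m_def power2_eq_square algebra_simps)
    ultimately show ?thesis by (simp add: coh_bound_def Let_def X_def N_def q(4))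
  qed
  ultimately show ?thesis by (simp add: P_def)
qed

text \<open>
  The transpose appears because the library defines the rank over a general field by the rows.
\<close>

lemma right_rank_transpose_eq_rank: "right_rank (transpose A) = rank A" for A :: "'a::field ^ 'n ^ 'm"
proof -
  have "transpose A *v x \<in> vec.span (rows A)" for x
    unfolding matrix_mult_sum
    by (intro vec.span_sum vec.span_scale vec.span_base) (auto simp: rows_def)
  moreover have "rows A \<subseteq> range (\<lambda>x. transpose A *v x)"
  proof
    fix r assume "r \<in> rows A"
    then obtain i where "r = row i A" by (auto simp: rows_def)
    then have "r = transpose A *v axis i 1"
      by (simp add: vec_eq_iff matrix_vector_mult_def axis_def transpose_def row_def if_distrib
        cong: if_cong)
    then show "r \<in> range (\<lambda>x. transpose A *v x)" by blast
  qed
  ultimately have "vec.span (range (\<lambda>x. transpose A *v x)) = vec.span (rows A)"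
    by (intro subset_antisym vec.span_minimal vec.subspace_span vec.span_mono) auto
  then show ?thesis
    unfolding right_rank_def right_dim_eq_dim row_rank_def_gen by (metis vec.dim_span)
qed

theorem theorem8:
  fixes N d :: nat and p :: real
  assumes "N = CARD('n::finite)" and "1 \<le> d" and "d < N" and "2 \<le> p"
  shows
    "(\<forall>A :: real ^ 'n ^ 'n. rank A = d \<and> (\<forall>i. A $ i $ i = 1) \<longrightarrow>
        (\<Sum>(i, j) \<in> {(i, j). i \<noteq> j}. norm (A $ i $ j) powr p) powr (1 / p)
          \<ge> coh_bound DIM(real) N d p) \<and>
     (\<forall>A :: complex ^ 'n ^ 'n. rank A = d \<and> (\<forall>i. A $ i $ i = 1) \<longrightarrow>
        (\<Sum>(i, j) \<in> {(i, j). i \<noteq> j}. norm (A $ i $ j) powr p) powr (1 / p)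
          \<ge> coh_bound DIM(complex) N d p) \<and>
     (\<forall>A :: quat ^ 'n ^ 'n. right_rank A = d \<and> (\<forall>i. A $ i $ i = 1) \<longrightarrow>
        (\<Sum>(i, j) \<in> {(i, j). i \<noteq> j}. norm (A $ i $ j) powr p) powr (1 / p)
          \<ge> coh_bound DIM(quat) N d p)"
proof (intro conjI allI impI; elim conjE)
  fix A :: "real ^ 'n ^ 'n"
  assume "rank A = d" "\<forall>i. A $ i $ i = 1"
  then show "coh_bound DIM(real) N d p
    \<le> (\<Sum>(i, j) \<in> {(i, j). i \<noteq> j}. norm (A $ i $ j) powr p) powr (1 / p)"
    using coh_bound_le_off_diagonal_norm[of d p A] assms by (simp add: right_rank_eq_rank)
next
  fix A :: "complex ^ 'n ^ 'n"
  assume A: "rank A = d" "\<forall>i. A $ i $ i = 1"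
  \<comment> \<open>Transposing keeps the unit diagonal and only permutes the off-diagonal
    entries.\<close>
  have "coh_bound DIM(complex) N d p
      \<le> (\<Sum>(i, j) \<in> {(i, j). i \<noteq> j}. norm (transpose A $ i $ j) powr p) powr (1 / p)"
    unfolding assms(1)
  proof (rule coh_bound_le_off_diagonal_norm)
    show "right_rank (transpose A) = d" using A by (simp add: right_rank_transpose_eq_rank)
  qed (use A assms in \<open>simp_all add: transpose_def\<close>)
  also have "(\<Sum>(i, j) \<in> {(i, j). i \<noteq> j}. norm (transpose A $ i $ j) powr p)
      = (\<Sum>(i, j) \<in> {(i, j). i \<noteq> j}. norm (A $ i $ j) powr p)"
    by (rule sum.reindex_bij_witness[of _ prod.swap prod.swap]) (auto simp: transpose_def)
  finally show "coh_bound DIM(complex) N d p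
    \<le> (\<Sum>(i, j) \<in> {(i, j). i \<noteq> j}. norm (A $ i $ j) powr p) powr (1 / p)" .
next
  fix A :: "quat ^ 'n ^ 'n"
  assume "right_rank A = d" "\<forall>i. A $ i $ i = 1"
  then show "coh_bound DIM(quat) N d p
    \<le> (\<Sum>(i, j) \<in> {(i, j). i \<noteq> j}. norm (A $ i $ j) powr p) powr (1 / p)"
    unfolding assms(1) using assms by (intro coh_bound_le_off_diagonal_norm) auto
qed

end
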